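(* The Banach space $c_0$ is not isometric to the Banach envelope of a non-locally convex quasi-Banach space with separating dual. That is, if $X$ is a quasi-Banach space whose dual separates points and whose Banach envelope is linearly isometric to $c_0$, then $X$ is locally convex.
   Context: A quasi-norm on a real or complex vector space $X$ is a function $\|\cdot\|:X\to[0,\infty)$ such that $\|x\|=0$ iff $x=0$; $\|\lambda x\|=|\lambda|\|x\|$ for all scalars $\lambda$; and $\|x+y\|\le\Delta(\|x\|+\|y\|)$ for some fixed $\Delta\ge1$ and all $x,y$. It induces the smallest linear topology for which the unit ball $B_X=\{x:\|x\|\le 1\}$ is a neighbourhood of $0$; a quasi-Banach space is a complete quasi-normed space. It is locally convex if it is linearly isomorphic to a Banach space (equivalently, its quasi-norm is equivalent to a norm). The dual $X^*$ (continuous linear functionals) is a Banach space under $\|x^*\|=\sup_{\|x\|\le1}|x^*(x)|$. $X$ has separating dual if for each nonzero $x\in X$ there is $x^*\in X^*$ with $x^*(x)\ne0$. Let $\delta:X\to X^{**}$, $\delta(x)(x^* )=x^*(x)$. The Banach envelope $\operatorname{co}X$ of $X$ is the closure of $\delta(X)$ in $X^{**}$ with the induced norm. *)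

theory Defs
  imports "HOL-Analysis.Analysis" "HOL-Library.Function_Algebras"
begin

text \<open>
  A space is given by a scalar multiplication \<open>s\<close> on an ambient vector space, a linear subspace
  \<open>X\<close> of it as carrier, and a functional \<open>q\<close> of which only the values on \<open>X\<close> matter.
  Carriers are needed because the dual, the bidual and the Banach envelope depend on \<open>q\<close>.
  The scalars are a \<open>real_normed_field\<close>, to be instantiated with \<open>real\<close> and \<open>complex\<close>.
\<close>

definition quasi_norm_on ::
    "('k::real_normed_field \<Rightarrow> 'v::ab_group_add \<Rightarrow> 'v) \<Rightarrow> 'v set \<Rightarrow> ('v \<Rightarrow> real) \<Rightarrow> bool" where
  "quasi_norm_on s X q \<longleftrightarrow>
     (\<forall>x\<in>X. 0 \<le> q x) \<and>
     (\<forall>x\<in>X. q x = 0 \<longleftrightarrow> x = 0) \<and>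
     (\<forall>c. \<forall>x\<in>X. q (s c x) = norm c * q x) \<and>
     (\<exists>\<Delta>\<ge>1. \<forall>x\<in>X. \<forall>y\<in>X. q (x + y) \<le> \<Delta> * (q x + q y))"

definition norm_on ::
    "('k::real_normed_field \<Rightarrow> 'v::ab_group_add \<Rightarrow> 'v) \<Rightarrow> 'v set \<Rightarrow> ('v \<Rightarrow> real) \<Rightarrow> bool" where
  "norm_on s X q \<longleftrightarrow>
     quasi_norm_on s X q \<and> (\<forall>x\<in>X. \<forall>y\<in>X. q (x + y) \<le> q x + q y)"

definition complete_wrt :: "'v::ab_group_add set \<Rightarrow> ('v \<Rightarrow> real) \<Rightarrow> bool" where
  "complete_wrt X q \<longleftrightarrow>
     (\<forall>u::nat \<Rightarrow> 'v. range u \<subseteq> X \<longrightarrow>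
        (\<forall>e>0. \<exists>N. \<forall>m\<ge>N. \<forall>n\<ge>N. q (u m - u n) < e) \<longrightarrow>
        (\<exists>x\<in>X. (\<lambda>n. q (u n - x)) \<longlonglongrightarrow> 0))"

definition quasi_banach_space ::
    "('k::real_normed_field \<Rightarrow> 'v::ab_group_add \<Rightarrow> 'v) \<Rightarrow> 'v set \<Rightarrow> ('v \<Rightarrow> real) \<Rightarrow> bool" where
  "quasi_banach_space s X q \<longleftrightarrow>
     vector_space s \<and> module.subspace s X \<and> quasi_norm_on s X q \<and> complete_wrt X q"

definition banach_space ::
    "('k::real_normed_field \<Rightarrow> 'v::ab_group_add \<Rightarrow> 'v) \<Rightarrow> 'v set \<Rightarrow> ('v \<Rightarrow> real) \<Rightarrow> bool" where
  "banach_space s X q \<longleftrightarrow>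
     vector_space s \<and> module.subspace s X \<and> norm_on s X q \<and> complete_wrt X q"

text \<open>
  The smallest linear topology on \<open>X\<close> for which the unit ball is a neighbourhood of \<open>0\<close>: the
  translates \<open>x + e B\<close> with \<open>e > 0\<close> form a base of neighbourhoods at \<open>x\<close>. The sets
  \<open>{y \<in> X. q (y - x) < e}\<close> are neighbourhoods of \<open>x\<close> but need not be open, as \<open>q\<close> need not be
  continuous.
\<close>

definition quasi_norm_topology ::
    "'v::ab_group_add set \<Rightarrow> ('v \<Rightarrow> real) \<Rightarrow> 'v topology" where
  "quasi_norm_topology X q =
     topology (\<lambda>U. U \<subseteq> X \<and> (\<forall>x\<in>U. \<exists>e>0. \<forall>y\<in>X. q (y - x) < e \<longrightarrow> y \<in> U))"

lemma openin_quasi_norm_topology: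
  "openin (quasi_norm_topology X q) U \<longleftrightarrow>
     U \<subseteq> X \<and> (\<forall>x\<in>U. \<exists>e>0. \<forall>y\<in>X. q (y - x) < e \<longrightarrow> y \<in> U)"
proof -
  let ?P = "\<lambda>U. U \<subseteq> X \<and> (\<forall>x\<in>U. \<exists>e>0. \<forall>y\<in>X. q (y - x) < e \<longrightarrow> y \<in> U)"
  have "istopology ?P"
    unfolding istopology_def
  proof (intro conjI allI impI)
    fix S T assume S: "?P S" and T: "?P T"
    show "S \<inter> T \<subseteq> X" using S by blast
    show "\<forall>x\<in>S \<inter> T. \<exists>e>0. \<forall>y\<in>X. q (y - x) < e \<longrightarrow> y \<in> S \<inter> T"
    proof
      fix x assume x: "x \<in> S \<inter> T"
      obtain d where d: "d > 0" "\<forall>y\<in>X. q (y - x) < d \<longrightarrow> y \<in> S" using S x by blast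
      obtain e where e: "e > 0" "\<forall>y\<in>X. q (y - x) < e \<longrightarrow> y \<in> T" using T x by blast
      show "\<exists>e>0. \<forall>y\<in>X. q (y - x) < e \<longrightarrow> y \<in> S \<inter> T"
        using d e by (intro exI[of _ "min d e"]) auto
    qed
  next
    fix K assume K: "\<forall>S\<in>K. ?P S"
    show "\<Union>K \<subseteq> X" using K by blast
    show "\<forall>x\<in>\<Union>K. \<exists>e>0. \<forall>y\<in>X. q (y - x) < e \<longrightarrow> y \<in> \<Union>K"
      using K by (meson UnionE UnionI)
  qed
  then show ?thesis
    by (simp add: quasi_norm_topology_def)
qed

lemma topspace_quasi_norm_topology: "topspace (quasi_norm_topology X q) = X"
proof -
  have "openin (quasi_norm_topology X q) X"
    unfolding openin_quasi_norm_topology by (auto intro: exI[of _ 1])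
  then show ?thesis
    unfolding topspace_def openin_quasi_norm_topology by blast
qed

definition linear_map_on ::
    "('k \<Rightarrow> 'v::ab_group_add \<Rightarrow> 'v) \<Rightarrow> 'v set \<Rightarrow> ('k \<Rightarrow> 'w::ab_group_add \<Rightarrow> 'w) \<Rightarrow> ('v \<Rightarrow> 'w) \<Rightarrow> bool"
  where
  "linear_map_on s X t T \<longleftrightarrow>
     (\<forall>x\<in>X. \<forall>y\<in>X. T (x + y) = T x + T y) \<and> (\<forall>c. \<forall>x\<in>X. T (s c x) = t c (T x))"

definition linearly_isomorphic ::
    "('k \<Rightarrow> 'v::ab_group_add \<Rightarrow> 'v) \<Rightarrow> 'v set \<Rightarrow> ('v \<Rightarrow> real) \<Rightarrow>
     ('k \<Rightarrow> 'w::ab_group_add \<Rightarrow> 'w) \<Rightarrow> 'w set \<Rightarrow> ('w \<Rightarrow> real) \<Rightarrow> bool" where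
  "linearly_isomorphic s X p t Y q \<longleftrightarrow>
     (\<exists>T. linear_map_on s X t T \<and>
          homeomorphic_map (quasi_norm_topology X p) (quasi_norm_topology Y q) T)"

definition linearly_isometric ::
    "('k \<Rightarrow> 'v::ab_group_add \<Rightarrow> 'v) \<Rightarrow> 'v set \<Rightarrow> ('v \<Rightarrow> real) \<Rightarrow>
     ('k \<Rightarrow> 'w::ab_group_add \<Rightarrow> 'w) \<Rightarrow> 'w set \<Rightarrow> ('w \<Rightarrow> real) \<Rightarrow> bool" where
  "linearly_isometric s X p t Y q \<longleftrightarrow>
     (\<exists>T. linear_map_on s X t T \<and> bij_betw T X Y \<and> (\<forall>x\<in>X. q (T x) = p x))"

text \<open>
  The Banach space may be sought inside the ambient space of \<open>X\<close> without loss of generality: the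
  structure of any Banach space linearly isomorphic to \<open>X\<close> can be transported to \<open>X\<close>.
\<close>

definition locally_convex_space ::
    "('k::real_normed_field \<Rightarrow> 'v::ab_group_add \<Rightarrow> 'v) \<Rightarrow> 'v set \<Rightarrow> ('v \<Rightarrow> real) \<Rightarrow> bool" where
  "locally_convex_space s X q \<longleftrightarrow>
     (\<exists>Y p. banach_space s Y p \<and> linearly_isomorphic s X q s Y p)"

definition fun_scale :: "'k::times \<Rightarrow> ('i \<Rightarrow> 'k) \<Rightarrow> 'i \<Rightarrow> 'k" where
  "fun_scale c f = (\<lambda>i. c * f i)"

text \<open>
  A functional on \<open>X\<close> is represented by its extension by \<open>0\<close> to the ambient space, so that
  distinct elements of the dual differ on \<open>X\<close>.
\<close>

definition dual_space ::
    "('k::real_normed_field \<Rightarrow> 'v::ab_group_add \<Rightarrow> 'v) \<Rightarrow> 'v set \<Rightarrow> ('v \<Rightarrow> real) \<Rightarrow> ('v \<Rightarrow> 'k) set" where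
  "dual_space s X q =
     {f. linear_map_on s X (*) f \<and>
         continuous_map (quasi_norm_topology X q) euclidean f \<and>
         (\<forall>x. x \<notin> X \<longrightarrow> f x = 0)}"

definition dual_norm ::
    "'v set \<Rightarrow> ('v \<Rightarrow> real) \<Rightarrow> ('v \<Rightarrow> 'k::real_normed_field) \<Rightarrow> real" where
  "dual_norm X q f = (SUP x\<in>{x\<in>X. q x \<le> 1}. norm (f x))"

definition separating_dual ::
    "('k::real_normed_field \<Rightarrow> 'v::ab_group_add \<Rightarrow> 'v) \<Rightarrow> 'v set \<Rightarrow> ('v \<Rightarrow> real) \<Rightarrow> bool" where
  "separating_dual s X q \<longleftrightarrow> (\<forall>x\<in>X. x \<noteq> 0 \<longrightarrow> (\<exists>f\<in>dual_space s X q. f x \<noteq> 0))"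

definition bidual_space ::
    "('k::real_normed_field \<Rightarrow> 'v::ab_group_add \<Rightarrow> 'v) \<Rightarrow> 'v set \<Rightarrow> ('v \<Rightarrow> real) \<Rightarrow>
     (('v \<Rightarrow> 'k) \<Rightarrow> 'k) set" where
  "bidual_space s X q = dual_space fun_scale (dual_space s X q) (dual_norm X q)"

definition bidual_norm ::
    "('k::real_normed_field \<Rightarrow> 'v::ab_group_add \<Rightarrow> 'v) \<Rightarrow> 'v set \<Rightarrow> ('v \<Rightarrow> real) \<Rightarrow>
     (('v \<Rightarrow> 'k) \<Rightarrow> 'k) \<Rightarrow> real" where
  "bidual_norm s X q = dual_norm (dual_space s X q) (dual_norm X q)"

definition canonical_map ::
    "('k::real_normed_field \<Rightarrow> 'v::ab_group_add \<Rightarrow> 'v) \<Rightarrow> 'v set \<Rightarrow> ('v \<Rightarrow> real) \<Rightarrow>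
     'v \<Rightarrow> ('v \<Rightarrow> 'k) \<Rightarrow> 'k" where
  "canonical_map s X q x = (\<lambda>f. if f \<in> dual_space s X q then f x else 0)"

text \<open>The norm of the Banach envelope is the restriction of \<open>bidual_norm\<close>.\<close>

definition banach_envelope ::
    "('k::real_normed_field \<Rightarrow> 'v::ab_group_add \<Rightarrow> 'v) \<Rightarrow> 'v set \<Rightarrow> ('v \<Rightarrow> real) \<Rightarrow>
     (('v \<Rightarrow> 'k) \<Rightarrow> 'k) set" where
  "banach_envelope s X q =
     quasi_norm_topology (bidual_space s X q) (bidual_norm s X q) closure_of
       (canonical_map s X q ` X)"

definition c0_space :: "(nat \<Rightarrow> 'k::real_normed_field) set" where
  "c0_space = {a. a \<longlonglongrightarrow> 0}"

definition sup_norm :: "(nat \<Rightarrow> 'k::real_normed_field) \<Rightarrow> real" where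
  "sup_norm a = (SUP n. norm (a n))"

end

theory Submission
  imports Defs
begin

text \<open>
  The canonical map followed by the isometry is a contraction \<open>J\<close> of \<open>X\<close> into \<open>c\<^sub>0\<close> with dense range,
  and \<open>x \<mapsto> \<Sum>n<N. a n * J x n\<close> has dual norm \<open>N\<close> whenever all \<open>a n\<close> have modulus \<open>1\<close>. Hence the image
  of the unit ball of \<open>X\<close> contains points whose first \<open>N\<close> coordinates are arbitrarily close to
  prescribed signs, all other coordinates being bounded by \<open>1\<close>. Half of such a point approximates a
  given \<open>y\<close> in the unit ball of \<open>c\<^sub>0\<close> with an error bounded away from \<open>1\<close>, so successive
  approximation and the completeness of \<open>X\<close> give \<open>x\<close> with \<open>J x = y\<close> and \<open>q x \<le> C\<close>. As \<open>J\<close> is injective,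
  \<open>q\<close> is equivalent to the norm of \<open>J x\<close>.
\<close>

section \<open>Linear maps on carriers and spaces of functions\<close>

lemma linear_map_on_diff:
  assumes "vector_space s" "module.subspace s X" "linear_map_on s X t T" "x \<in> X" "y \<in> X"
  shows "T (x - y) = T x - T y"
proof -
  interpret vector_space s by fact
  have "T ((x - y) + y) = T (x - y) + T y"
    using assms subspace_diff unfolding linear_map_on_def by blast
  then show ?thesis by simp
qed

lemma vector_space_fun_scale: "vector_space (fun_scale :: 'k::field \<Rightarrow> ('i \<Rightarrow> 'k) \<Rightarrow> 'i \<Rightarrow> 'k)"
  by unfold_locales (auto simp: fun_scale_def fun_eq_iff algebra_simps)

section \<open>Quasi-normed spaces, bounded functionals and the dual norm\<close>

locale quasi_normed_space = vector_space s
  for s :: "'k::real_normed_field \<Rightarrow> 'v::ab_group_add \<Rightarrow> 'v" +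
  fixes X :: "'v set" and q :: "'v \<Rightarrow> real"
  assumes subspace: "subspace X"
    and quasi_norm: "quasi_norm_on s X q"
begin

lemma q_nonneg: "x \<in> X \<Longrightarrow> 0 \<le> q x"
  and q_eq_0_iff: "x \<in> X \<Longrightarrow> q x = 0 \<longleftrightarrow> x = 0"
  and q_scale: "x \<in> X \<Longrightarrow> q (s c x) = norm c * q x"
  using quasi_norm unfolding quasi_norm_on_def by auto

lemma zero_in: "0 \<in> X"
  and add_in: "x \<in> X \<Longrightarrow> y \<in> X \<Longrightarrow> x + y \<in> X"
  and diff_in: "x \<in> X \<Longrightarrow> y \<in> X \<Longrightarrow> x - y \<in> X"
  and scale_in: "x \<in> X \<Longrightarrow> s c x \<in> X"
  using subspace subspace_0 subspace_add subspace_diff subspace_scale by auto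

lemma quasi_triangle: "\<exists>\<Delta>\<ge>1. \<forall>x\<in>X. \<forall>y\<in>X. q (x + y) \<le> \<Delta> * (q x + q y)"
  using quasi_norm unfolding quasi_norm_on_def by (elim conjE)

lemma q_0: "q 0 = 0"
  using q_eq_0_iff zero_in by blast

lemma q_minus_commute:
  assumes "x \<in> X" "y \<in> X"
  shows "q (x - y) = q (y - x)"
proof -
  have "s (- 1) (y - x) = x - y" by (simp only: scale_minus_left scale_one minus_diff_eq)
  then show ?thesis using q_scale[of "y - x" "- 1"] assms diff_in by simp
qed

lemma linear_0: "linear_map_on s X t f \<Longrightarrow> f 0 = 0"
  using linear_map_on_diff[OF vector_space_axioms subspace _ zero_in zero_in] by fastforce

text \<open>Continuity at \<open>0\<close> gives a ball on which \<open>f\<close> stays below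
  \<open>1\<close>, and homogeneity turns this into a linear bound. Conversely, a bound makes
  \<open>f\<close> Lipschitz in terms of \<open>q (y - x)\<close>, which is the form in which
  \<open>openin_quasi_norm_topology\<close> tests openness.\<close>

lemma dual_space_iff:
  "f \<in> dual_space s X q \<longleftrightarrow>
     linear_map_on s X (*) f \<and> (\<exists>C. \<forall>x\<in>X. norm (f x) \<le> C * q x) \<and> (\<forall>x. x \<notin> X \<longrightarrow> f x = 0)"
proof -
  have "continuous_map (quasi_norm_topology X q) euclidean f \<longleftrightarrow> (\<exists>C. \<forall>x\<in>X. norm (f x) \<le> C * q x)"
    if lin: "linear_map_on s X (*) f"
  proof
    assume "continuous_map (quasi_norm_topology X q) euclidean f"
    then have "openin (quasi_norm_topology X q) {x \<in> X. f x \<in> ball 0 1}"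
      unfolding continuous_map_def topspace_quasi_norm_topology by (metis open_ball open_openin)
    moreover have "f 0 = 0" using lin linear_0 by blast
    ultimately obtain e where e: "e > 0" "\<And>y. y \<in> X \<Longrightarrow> q y < e \<Longrightarrow> norm (f y) < 1"
      unfolding openin_quasi_norm_topology using zero_in by (auto dest!: spec[of _ 0])
    have "norm (f x) \<le> (2 / e) * q x" if x: "x \<in> X" for x
    proof (cases "x = 0")
      case True
      then show ?thesis using \<open>f 0 = 0\<close> q_0 by simp
    next
      case False
      then have qx: "q x > 0" using q_nonneg[OF x] q_eq_0_iff[OF x] by linarith
      \<comment> \<open>This scalar brings \<open>x\<close> to quasi-norm \<open>e / 2\<close>,
        strictly inside the ball.\<close>
      define c :: 'k where "c = of_real (e / (2 * q x))"
      have nc: "norm c = e / (2 * q x)"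
        using qx e(1) unfolding c_def by (simp only: norm_of_real) simp
      have "q (s c x) < e" using qx e(1) by (simp add: q_scale x nc)
      then have "norm (f (s c x)) < 1" using e(2) scale_in x by blast
      moreover have "f (s c x) = c * f x" using lin x unfolding linear_map_on_def by blast
      ultimately have "e / (2 * q x) * norm (f x) < 1" by (simp add: norm_mult nc)
      then show ?thesis using qx e(1) by (simp add: field_simps)
    qed
    then show "\<exists>C. \<forall>x\<in>X. norm (f x) \<le> C * q x" by blast
  next
    assume "\<exists>C. \<forall>x\<in>X. norm (f x) \<le> C * q x"
    then obtain C where C: "\<And>x. x \<in> X \<Longrightarrow> norm (f x) \<le> C * q x" by blast
    have "openin (quasi_norm_topology X q) {x \<in> X. f x \<in> U}" if U: "open U" for U
      unfolding openin_quasi_norm_topology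
    proof (intro conjI ballI)
      fix x assume x: "x \<in> {x \<in> X. f x \<in> U}"
      then obtain r where r: "r > 0" "ball (f x) r \<subseteq> U" using U open_contains_ball by blast
      \<comment> \<open>The sign of \<open>C\<close> is unknown; \<open>\<bar>C\<bar> + 1\<close>
        keeps the radius positive.\<close>
      have "y \<in> {x \<in> X. f x \<in> U}" if y: "y \<in> X" "q (y - x) < r / (\<bar>C\<bar> + 1)" for y
      proof -
        have "norm (f y - f x) \<le> C * q (y - x)"
          using C[of "y - x"] linear_map_on_diff[OF vector_space_axioms subspace lin, of y x] x y diff_in
          by auto
        also have "\<dots> \<le> (\<bar>C\<bar> + 1) * q (y - x)"
          using q_nonneg[of "y - x"] x y diff_in by (intro mult_right_mono) auto
        also have "\<dots> < r" using y(2) by (simp add: field_simps)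
        finally have "f y \<in> ball (f x) r" by (simp add: dist_norm norm_minus_commute)
        then show ?thesis using r y by blast
      qed
      moreover have "r / (\<bar>C\<bar> + 1) > 0" using r by simp
      ultimately show "\<exists>e>0. \<forall>y\<in>X. q (y - x) < e \<longrightarrow> y \<in> {x \<in> X. f x \<in> U}" by blast
    qed blast
    then show "continuous_map (quasi_norm_topology X q) euclidean f"
      unfolding continuous_map_def topspace_quasi_norm_topology by auto
  qed
  then show ?thesis unfolding dual_space_def by blast
qed

lemma dual_norm_le:
  assumes "0 \<le> C" "\<And>x. x \<in> X \<Longrightarrow> norm (f x) \<le> C * q x"
  shows "dual_norm X q f \<le> C"
  unfolding dual_norm_def
proof (rule cSUP_least)
  show "{x \<in> X. q x \<le> 1} \<noteq> {}" using zero_in q_0 by force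
  show "norm (f x) \<le> C" if "x \<in> {x \<in> X. q x \<le> 1}" for x
    using that assms(2)[of x] mult_left_le[of "q x" C] assms(1) by auto
qed

text \<open>A supremum of reals can be used as an upper bound only if the set is bounded above;
  every later use of \<open>dual_norm\<close> from above rests on this.\<close>

lemma dual_bdd:
  assumes "f \<in> dual_space s X q"
  shows "bdd_above ((\<lambda>x. norm (f x)) ` {x \<in> X. q x \<le> 1})"
proof -
  obtain C where C: "\<And>x. x \<in> X \<Longrightarrow> norm (f x) \<le> C * q x" using assms dual_space_iff by blast
  have "norm (f x) \<le> \<bar>C\<bar>" if "x \<in> X" "q x \<le> 1" for x
  proof -
    have "norm (f x) \<le> \<bar>C\<bar> * q x"
      by (rule order_trans[OF C[OF that(1)] mult_right_mono[OF abs_ge_self q_nonneg[OF that(1)]]])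
    then show ?thesis using mult_left_le[of "q x" "\<bar>C\<bar>"] that(2) by simp
  qed
  then show ?thesis by (auto intro!: bdd_aboveI)
qed

lemma dual_norm_nonneg:
  assumes "f \<in> dual_space s X q"
  shows "0 \<le> dual_norm X q f"
  unfolding dual_norm_def
  by (rule order_trans[OF norm_ge_zero cSUP_upper[OF _ dual_bdd[OF assms], of 0]])
    (simp add: zero_in q_0)

lemma norm_le_dual_norm:
  assumes f: "f \<in> dual_space s X q" and x: "x \<in> X"
  shows "norm (f x) \<le> dual_norm X q f * q x"
proof (cases "x = 0")
  case True
  then show ?thesis using f linear_0 q_0 unfolding dual_space_def by auto
next
  case False
  then have qx: "q x > 0" using q_nonneg[OF x] q_eq_0_iff[OF x] by linarith
  define c :: 'k where "c = of_real (1 / q x)"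
  have nc: "norm c = 1 / q x"
    using qx unfolding c_def by (simp only: norm_of_real) simp
  have "s c x \<in> {x \<in> X. q x \<le> 1}" using qx by (simp add: q_scale x nc scale_in)
  then have "norm (f (s c x)) \<le> dual_norm X q f"
    unfolding dual_norm_def using cSUP_upper[OF _ dual_bdd[OF f]] by blast
  moreover have "f (s c x) = c * f x"
    using f x unfolding dual_space_def linear_map_on_def by blast
  ultimately have "norm (f x) / q x \<le> dual_norm X q f" by (simp add: norm_mult nc)
  then show ?thesis using qx by (simp add: field_simps)
qed

lemma subspace_dual_space: "module.subspace fun_scale (dual_space s X q)"
proof -
  interpret F: vector_space "fun_scale :: 'k \<Rightarrow> ('v \<Rightarrow> 'k) \<Rightarrow> _" by (rule vector_space_fun_scale)
  show ?thesis
  proof (rule F.subspaceI)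
    show "0 \<in> dual_space s X q"
      unfolding dual_space_iff linear_map_on_def by (auto intro!: exI[of _ 0])
  next
    fix f g assume fg: "f \<in> dual_space s X q" "g \<in> dual_space s X q"
    have "norm ((f + g) x) \<le> (dual_norm X q f + dual_norm X q g) * q x" if "x \<in> X" for x
      using norm_le_dual_norm[OF fg(1) that] norm_le_dual_norm[OF fg(2) that]
        norm_triangle_ineq[of "f x" "g x"] by (simp add: distrib_right)
    moreover have "linear_map_on s X (*) (f + g)" "\<forall>x. x \<notin> X \<longrightarrow> (f + g) x = 0"
      using fg unfolding dual_space_def linear_map_on_def by (auto simp: algebra_simps)
    ultimately show "f + g \<in> dual_space s X q" unfolding dual_space_iff by blast
  next
    fix c f assume f: "f \<in> dual_space s X q"
    have "norm (fun_scale c f x) \<le> (norm c * dual_norm X q f) * q x" if "x \<in> X" for x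
      using mult_left_mono[OF norm_le_dual_norm[OF f that], of "norm c"]
      by (simp add: fun_scale_def norm_mult algebra_simps)
    moreover have "linear_map_on s X (*) (fun_scale c f)" "\<forall>x. x \<notin> X \<longrightarrow> fun_scale c f x = 0"
      using f unfolding dual_space_def linear_map_on_def fun_scale_def by (auto simp: algebra_simps)
    ultimately show "fun_scale c f \<in> dual_space s X q" unfolding dual_space_iff by blast
  qed
qed

lemma dual_norm_triangle:
  assumes fg: "f \<in> dual_space s X q" "g \<in> dual_space s X q"
  shows "dual_norm X q (f + g) \<le> dual_norm X q f + dual_norm X q g"
proof (rule dual_norm_le)
  show "norm ((f + g) x) \<le> (dual_norm X q f + dual_norm X q g) * q x" if "x \<in> X" for x
    using norm_le_dual_norm[OF fg(1) that] norm_le_dual_norm[OF fg(2) that]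
      norm_triangle_ineq[of "f x" "g x"] by (simp add: distrib_right)
qed (use fg dual_norm_nonneg in simp)

text \<open>The triangle inequality is inherited from the norm of the scalars and not from
  \<open>q\<close>, so the dual is normed although \<open>X\<close> is only quasi-normed.\<close>

lemma norm_on_dual_norm: "norm_on fun_scale (dual_space s X q) (dual_norm X q)"
proof -
  interpret F: vector_space "fun_scale :: 'k \<Rightarrow> ('v \<Rightarrow> 'k) \<Rightarrow> _" by (rule vector_space_fun_scale)
  have eq0: "dual_norm X q f = 0 \<longleftrightarrow> f = 0" if f: "f \<in> dual_space s X q" for f
  proof
    assume "dual_norm X q f = 0"
    then have "f x = 0" if "x \<in> X" for x using norm_le_dual_norm[OF f that] by simp
    moreover have "f x = 0" if "x \<notin> X" for x using f that unfolding dual_space_def by blast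
    ultimately show "f = 0" by (auto simp: fun_eq_iff)
  next
    assume "f = 0"
    then have "dual_norm X q f \<le> 0" by (intro dual_norm_le) auto
    then show "dual_norm X q f = 0" using dual_norm_nonneg[OF f] by simp
  qed
  have le: "dual_norm X q (fun_scale c f) \<le> norm c * dual_norm X q f"
    if f: "f \<in> dual_space s X q" for c f
  proof (rule dual_norm_le)
    show "norm (fun_scale c f x) \<le> (norm c * dual_norm X q f) * q x" if "x \<in> X" for x
      using mult_left_mono[OF norm_le_dual_norm[OF f that], of "norm c"]
      by (simp add: fun_scale_def norm_mult algebra_simps)
  qed (use dual_norm_nonneg[OF f] in simp)
  have scale: "dual_norm X q (fun_scale c f) = norm c * dual_norm X q f"
    if f: "f \<in> dual_space s X q" for c f
  proof (cases "c = 0")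
    case True
    then have "fun_scale c f = 0" by (auto simp: fun_scale_def)
    then show ?thesis using True eq0 F.subspace_0[OF subspace_dual_space] by simp
  next
    case False
    \<comment> \<open>Applying \<open>le\<close> to the inverse scalar gives the reverse
      inequality.\<close>
    have "fun_scale (inverse c) (fun_scale c f) = f" using False by (simp add: F.scale_scale)
    then have "dual_norm X q f \<le> norm (inverse c) * dual_norm X q (fun_scale c f)"
      using le[OF F.subspace_scale[OF subspace_dual_space f], of "inverse c" c] by simp
    then have "norm c * dual_norm X q f \<le> dual_norm X q (fun_scale c f)"
      using False by (simp add: nonzero_norm_inverse pos_le_divide_eq mult.commute
          divide_inverse_commute[symmetric] del: inverse_eq_divide)
    then show ?thesis using le[OF f, of c] by simp
  qed
  show ?thesis
    unfolding norm_on_def quasi_norm_on_def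
    using dual_norm_nonneg eq0 scale dual_norm_triangle by (auto intro!: exI[of _ 1])
qed

text \<open>The dual is again an instance of the locale, so everything proved about duals applies to
  the bidual as well.\<close>

lemma quasi_normed_space_dual: "quasi_normed_space fun_scale (dual_space s X q) (dual_norm X q)"
  using vector_space_fun_scale subspace_dual_space norm_on_dual_norm
  unfolding quasi_normed_space_def quasi_normed_space_axioms_def norm_on_def by blast

section \<open>Closures of subspaces and equivalent norms\<close>

lemma closure_of_iff:
  assumes "norm_on s X q" "A \<subseteq> X"
  shows "x \<in> quasi_norm_topology X q closure_of A \<longleftrightarrow> x \<in> X \<and> (\<forall>e>0. \<exists>y\<in>A. q (y - x) < e)"
proof (intro iffI conjI allI impI)
  assume x: "x \<in> quasi_norm_topology X q closure_of A"
  then show xX: "x \<in> X" by (simp add: in_closure_of topspace_quasi_norm_topology)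
  fix e :: real assume e: "e > 0"
  \<comment> \<open>This is where a genuine norm is required: for a quasi-norm these balls are
    neighbourhoods but need not be open.\<close>
  have "openin (quasi_norm_topology X q) {y \<in> X. q (y - x) < e}"
    unfolding openin_quasi_norm_topology
  proof (intro conjI ballI)
    fix y assume y: "y \<in> {y \<in> X. q (y - x) < e}"
    have "q (z - x) < e" if z: "z \<in> X" "q (z - y) < e - q (y - x)" for z
    proof -
      have "q ((z - y) + (y - x)) \<le> q (z - y) + q (y - x)"
        using assms(1) diff_in y z xX unfolding norm_on_def by blast
      then show ?thesis using z by simp
    qed
    then show "\<exists>d>0. \<forall>z\<in>X. q (z - y) < d \<longrightarrow> z \<in> {y \<in> X. q (y - x) < e}"
      using y by (intro exI[of _ "e - q (y - x)"]) auto
  qed blast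
  then show "\<exists>y\<in>A. q (y - x) < e"
    using x xX e q_0 unfolding in_closure_of by (auto dest: spec[of _ "{y \<in> X. q (y - x) < e}"])
next
  assume R: "x \<in> X \<and> (\<forall>e>0. \<exists>y\<in>A. q (y - x) < e)"
  have "\<exists>y. y \<in> A \<and> y \<in> U" if U: "x \<in> U" "openin (quasi_norm_topology X q) U" for U
  proof -
    obtain e where "e > 0" "\<forall>y\<in>X. q (y - x) < e \<longrightarrow> y \<in> U"
      using U unfolding openin_quasi_norm_topology by blast
    then show ?thesis using R assms(2) by blast
  qed
  then show "x \<in> quasi_norm_topology X q closure_of A"
    using R by (auto simp: in_closure_of topspace_quasi_norm_topology)
qed

text \<open>This serves the Banach envelope: the isometry onto \<open>c0_space\<close> is linear
  only on the envelope, so differences of its elements must stay there.\<close>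

lemma subspace_closure_of:
  assumes p: "norm_on s X q" and A: "A \<subseteq> X" "subspace A"
  shows "subspace (quasi_norm_topology X q closure_of A)"
proof (rule subspaceI)
  show "0 \<in> quasi_norm_topology X q closure_of A"
    unfolding closure_of_iff[OF p A(1)] using zero_in subspace_0[OF A(2)] q_0 by force
next
  fix x y assume "x \<in> quasi_norm_topology X q closure_of A" "y \<in> quasi_norm_topology X q closure_of A"
  then have x: "x \<in> X" "\<And>e. e > 0 \<Longrightarrow> \<exists>a\<in>A. q (a - x) < e"
    and y: "y \<in> X" "\<And>e. e > 0 \<Longrightarrow> \<exists>a\<in>A. q (a - y) < e"
    unfolding closure_of_iff[OF p A(1)] by blast+
  have "\<exists>c\<in>A. q (c - (x + y)) < e" if e: "e > 0" for e
  proof -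
    obtain a b where ab: "a \<in> A" "q (a - x) < e / 2" "b \<in> A" "q (b - y) < e / 2"
      using x(2)[of "e / 2"] y(2)[of "e / 2"] half_gt_zero[OF e] by blast
    have "q ((a - x) + (b - y)) \<le> q (a - x) + q (b - y)"
      using p ab A(1) x(1) y(1) diff_in unfolding norm_on_def by blast
    then have "q ((a + b) - (x + y)) < e" using ab by (simp add: algebra_simps)
    then show ?thesis using subspace_add[OF A(2)] ab by blast
  qed
  then show "x + y \<in> quasi_norm_topology X q closure_of A"
    unfolding closure_of_iff[OF p A(1)] using x y add_in by blast
next
  fix c x assume "x \<in> quasi_norm_topology X q closure_of A"
  then have x: "x \<in> X" "\<And>e. e > 0 \<Longrightarrow> \<exists>a\<in>A. q (a - x) < e"
    unfolding closure_of_iff[OF p A(1)] by blast+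
  have "\<exists>b\<in>A. q (b - s c x) < e" if e: "e > 0" for e
  proof -
    \<comment> \<open>Adding \<open>1\<close> avoids a division by zero for
      \<open>c = 0\<close>.\<close>
    have "e / (norm c + 1) > 0" using e by (simp add: add_nonneg_pos)
    then obtain a where a: "a \<in> A" "q (a - x) < e / (norm c + 1)" using x(2) by blast
    have ax: "a - x \<in> X" using a A(1) x(1) diff_in by blast
    have "q (s c a - s c x) = norm c * q (a - x)"
      using q_scale[OF ax, of c] by (simp add: scale_right_diff_distrib)
    also have "\<dots> \<le> (norm c + 1) * q (a - x)"
      using q_nonneg[OF ax] by (simp add: distrib_right)
    also have "\<dots> < e"
      using a(2) by (simp add: pos_less_divide_eq add_nonneg_pos mult.commute)
    finally show ?thesis using subspace_scale[OF A(2)] a by blast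
  qed
  then show "s c x \<in> quasi_norm_topology X q closure_of A"
    unfolding closure_of_iff[OF p A(1)] using x scale_in by blast
qed

text \<open>The identity is the isomorphism onto \<open>X\<close> with the norm \<open>p\<close>.
  Completeness transfers because \<open>ge\<close> makes \<open>p\<close>-Cauchy sequences
  \<open>q\<close>-Cauchy and \<open>le\<close> makes \<open>q\<close>-limits
  \<open>p\<close>-limits.\<close>

lemma locally_convex_space_if_equivalent_norm:
  assumes complete: "complete_wrt X q" and p: "norm_on s X p"
    and le: "\<And>x. x \<in> X \<Longrightarrow> p x \<le> q x" and ge: "\<And>x. x \<in> X \<Longrightarrow> q x \<le> C * p x"
  shows "locally_convex_space s X q"
proof -
  define K where "K = \<bar>C\<bar> + 1"
  have K: "K > 0" unfolding K_def by simp
  have p_nonneg: "0 \<le> p x" if "x \<in> X" for x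
    using p that unfolding norm_on_def quasi_norm_on_def by simp
  have qK: "q x \<le> K * p x" if "x \<in> X" for x
    unfolding K_def by (rule order_trans[OF ge[OF that] mult_right_mono[OF _ p_nonneg[OF that]]]) simp
  have "complete_wrt X p"
    unfolding complete_wrt_def
  proof (intro allI impI)
    fix u :: "nat \<Rightarrow> 'v"
    assume u: "range u \<subseteq> X" and cauchy: "\<forall>e>0. \<exists>N. \<forall>m\<ge>N. \<forall>n\<ge>N. p (u m - u n) < e"
    have uX: "u n \<in> X" for n using u by blast
    have "\<exists>N. \<forall>m\<ge>N. \<forall>n\<ge>N. q (u m - u n) < e" if "e > 0" for e
    proof -
      have "e / K > 0" using that K by simp
      then obtain N where N: "\<forall>m\<ge>N. \<forall>n\<ge>N. p (u m - u n) < e / K" using cauchy by blast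
      have "q (u m - u n) < e" if "m \<ge> N" "n \<ge> N" for m n
      proof -
        have "p (u m - u n) < e / K" using N that by blast
        then have "K * p (u m - u n) < e" using K by (simp add: field_simps)
        then show ?thesis using qK[OF diff_in[OF uX uX], of m n] by linarith
      qed
      then show ?thesis by blast
    qed
    then obtain x where x: "x \<in> X" "(\<lambda>n. q (u n - x)) \<longlonglongrightarrow> 0"
      using complete u unfolding complete_wrt_def by blast
    have "(\<lambda>n. p (u n - x)) \<longlonglongrightarrow> 0"
      by (rule tendsto_sandwich[OF _ _ tendsto_const x(2)])
        (use p_nonneg le diff_in[OF uX x(1)] in auto)
    then show "\<exists>x\<in>X. (\<lambda>n. p (u n - x)) \<longlonglongrightarrow> 0" using x by blast
  qed
  moreover have "quasi_norm_topology X q = quasi_norm_topology X p"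
  proof (rule topology_eq[THEN iffD2], rule allI)
    fix U
    have "(\<exists>e>0. \<forall>y\<in>X. q (y - x) < e \<longrightarrow> y \<in> U) \<longleftrightarrow> (\<exists>e>0. \<forall>y\<in>X. p (y - x) < e \<longrightarrow> y \<in> U)"
      if x: "x \<in> X" for x
    proof
      assume "\<exists>e>0. \<forall>y\<in>X. q (y - x) < e \<longrightarrow> y \<in> U"
      then obtain e where e: "e > 0" "\<And>y. y \<in> X \<Longrightarrow> q (y - x) < e \<Longrightarrow> y \<in> U" by blast
      have "y \<in> U" if y: "y \<in> X" "p (y - x) < e / K" for y
      proof -
        have "K * p (y - x) < e" using K y by (simp add: field_simps)
        then show ?thesis using e(2)[OF y(1)] qK[OF diff_in[OF y(1) x]] by linarith
      qed
      then show "\<exists>e>0. \<forall>y\<in>X. p (y - x) < e \<longrightarrow> y \<in> U"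
        using e(1) K by (intro exI[of _ "e / K"]) auto
    next
      assume "\<exists>e>0. \<forall>y\<in>X. p (y - x) < e \<longrightarrow> y \<in> U"
      then show "\<exists>e>0. \<forall>y\<in>X. q (y - x) < e \<longrightarrow> y \<in> U"
        using le diff_in x by (meson order_le_less_trans)
    qed
    then show "openin (quasi_norm_topology X q) U \<longleftrightarrow> openin (quasi_norm_topology X p) U"
      unfolding openin_quasi_norm_topology by blast
  qed
  then have "linearly_isomorphic s X q s X p"
    unfolding linearly_isomorphic_def linear_map_on_def
    by (intro exI[of _ id]) (simp add: homeomorphic_map_id)
  ultimately show ?thesis
    unfolding locally_convex_space_def banach_space_def
    using vector_space_axioms subspace p by blast
qed

section \<open>The bidual, the canonical map and the Banach envelope\<close>

lemma quasi_normed_space_bidual: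
  "quasi_normed_space fun_scale (bidual_space s X q) (bidual_norm s X q)"
  unfolding bidual_space_def bidual_norm_def
  by (rule quasi_normed_space.quasi_normed_space_dual[OF quasi_normed_space_dual])

lemma norm_on_bidual_norm: "norm_on fun_scale (bidual_space s X q) (bidual_norm s X q)"
  unfolding bidual_space_def bidual_norm_def
  by (rule quasi_normed_space.norm_on_dual_norm[OF quasi_normed_space_dual])

lemma canonical_map_in_bidual:
  assumes "x \<in> X"
  shows "canonical_map s X q x \<in> bidual_space s X q"
  unfolding bidual_space_def quasi_normed_space.dual_space_iff[OF quasi_normed_space_dual]
proof (intro conjI)
  interpret D: quasi_normed_space fun_scale "dual_space s X q" "dual_norm X q"
    by (rule quasi_normed_space_dual)
  show "linear_map_on fun_scale (dual_space s X q) (*) (canonical_map s X q x)"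
    unfolding linear_map_on_def canonical_map_def
    using D.add_in D.scale_in by (simp add: fun_scale_def)
  show "\<exists>C. \<forall>f\<in>dual_space s X q. norm (canonical_map s X q x f) \<le> C * dual_norm X q f"
    using norm_le_dual_norm[OF _ assms]
    by (intro exI[of _ "q x"]) (auto simp: canonical_map_def mult.commute)
  show "\<forall>f. f \<notin> dual_space s X q \<longrightarrow> canonical_map s X q x f = 0"
    by (simp add: canonical_map_def)
qed

text \<open>This is \<open>norm_le_dual_norm\<close> read with \<open>x\<close> fixed and
  \<open>f\<close> varying.\<close>

lemma bidual_norm_canonical_map_le:
  assumes "x \<in> X"
  shows "bidual_norm s X q (canonical_map s X q x) \<le> q x"
  unfolding bidual_norm_def
proof (rule quasi_normed_space.dual_norm_le[OF quasi_normed_space_dual q_nonneg[OF assms]])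
  show "norm (canonical_map s X q x f) \<le> q x * dual_norm X q f" if "f \<in> dual_space s X q" for f
    using norm_le_dual_norm[OF that assms] that by (simp add: canonical_map_def mult.commute)
qed

text \<open>Here \<open>norm_le_dual_norm\<close> is applied one level up, to evaluation at
  \<open>x\<close>. Thus \<open>q\<close> may be replaced by the smaller envelope norm without
  increasing the norm of a functional.\<close>

lemma norm_le_dual_norm_bidual_norm:
  assumes "f \<in> dual_space s X q" "x \<in> X"
  shows "norm (f x) \<le> dual_norm X q f * bidual_norm s X q (canonical_map s X q x)"
  using quasi_normed_space.norm_le_dual_norm[OF quasi_normed_space_dual
      canonical_map_in_bidual[unfolded bidual_space_def, OF assms(2)] assms(1)] assms(1)
  unfolding bidual_norm_def by (simp add: canonical_map_def mult.commute)

lemma linear_canonical_map: "linear_map_on s X fun_scale (canonical_map s X q)"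
  unfolding linear_map_on_def canonical_map_def fun_scale_def fun_eq_iff
  by (auto simp: dual_space_def linear_map_on_def)

lemma banach_envelope_iff:
  "z \<in> banach_envelope s X q \<longleftrightarrow>
     z \<in> bidual_space s X q \<and> (\<forall>e>0. \<exists>x\<in>X. bidual_norm s X q (canonical_map s X q x - z) < e)"
  unfolding banach_envelope_def
  by (subst quasi_normed_space.closure_of_iff[OF quasi_normed_space_bidual norm_on_bidual_norm])
    (auto simp: canonical_map_in_bidual)

lemma subspace_banach_envelope: "module.subspace fun_scale (banach_envelope s X q)"
  unfolding banach_envelope_def
proof (rule quasi_normed_space.subspace_closure_of[OF quasi_normed_space_bidual norm_on_bidual_norm])
  interpret B: quasi_normed_space fun_scale "bidual_space s X q" "bidual_norm s X q"
    by (rule quasi_normed_space_bidual)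
  show "canonical_map s X q ` X \<subseteq> bidual_space s X q" using canonical_map_in_bidual by blast
  show "B.subspace (canonical_map s X q ` X)"
  proof (rule B.subspaceI)
    show "0 \<in> canonical_map s X q ` X"
      using linear_0[OF linear_canonical_map] zero_in by (metis imageI)
  next
    fix y z assume "y \<in> canonical_map s X q ` X" "z \<in> canonical_map s X q ` X"
    then obtain x w where "x \<in> X" "w \<in> X" "y = canonical_map s X q x" "z = canonical_map s X q w"
      by blast
    then have "y + z = canonical_map s X q (x + w)"
      using linear_canonical_map unfolding linear_map_on_def by simp
    then show "y + z \<in> canonical_map s X q ` X" using add_in \<open>x \<in> X\<close> \<open>w \<in> X\<close> by blast
  next
    fix c y assume "y \<in> canonical_map s X q ` X"
    then obtain x where "x \<in> X" "y = canonical_map s X q x" by blast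
    then have "fun_scale c y = canonical_map s X q (s c x)"
      using linear_canonical_map unfolding linear_map_on_def by simp
    then show "fun_scale c y \<in> canonical_map s X q ` X" using scale_in \<open>x \<in> X\<close> by blast
  qed
qed

lemma canonical_map_in_banach_envelope:
  assumes "x \<in> X"
  shows "canonical_map s X q x \<in> banach_envelope s X q"
proof -
  interpret B: quasi_normed_space fun_scale "bidual_space s X q" "bidual_norm s X q"
    by (rule quasi_normed_space_bidual)
  show ?thesis
    unfolding banach_envelope_iff using assms canonical_map_in_bidual B.q_0 by force
qed

end

section \<open>The sup norm on null sequences and almost extremal sums\<close>

lemma norm_le_sup_norm:
  assumes "a \<in> c0_space"
  shows "norm (a n) \<le> sup_norm a"
proof -
  have "Bseq a" using assms unfolding c0_space_def by (auto intro: convergent_imp_Bseq convergentI)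
  then have "bdd_above (range (\<lambda>n. norm (a n)))" unfolding Bseq_def by (metis bdd_aboveI2)
  then show ?thesis unfolding sup_norm_def by (auto intro: cSUP_upper)
qed

lemma sup_norm_le: "(\<And>n. norm (a n) \<le> C) \<Longrightarrow> sup_norm a \<le> C"
  unfolding sup_norm_def by (auto intro: cSUP_least)

lemma diff_c0_space: "a \<in> c0_space \<Longrightarrow> b \<in> c0_space \<Longrightarrow> a - b \<in> c0_space"
  unfolding c0_space_def using tendsto_diff[of a 0 sequentially b 0] by (simp add: fun_diff_def)

lemma sup_norm_nonneg: "a \<in> c0_space \<Longrightarrow> 0 \<le> sup_norm a"
  using norm_le_sup_norm[of a 0] norm_ge_zero order_trans by blast

text \<open>Let \<open>u\<close> be the direction of the sum. The inner products with
  \<open>u\<close> are at most \<open>1\<close> and add up to more than \<open>card A - h\<close>,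
  so each exceeds \<open>1 - h\<close>; expanding the square of \<open>norm (w i - u)\<close> gives
  \<open>2 * h\<close>. The condition \<open>h < 1\<close> keeps the sum nonzero. Working in
  \<open>real_inner\<close> covers real and complex scalars at once.\<close>

lemma near_extremal_sum_aligned:
  fixes w :: "'i \<Rightarrow> 'a::real_inner"
  assumes A: "finite A" "A \<noteq> {}" and w: "\<And>i. i \<in> A \<Longrightarrow> norm (w i) \<le> 1"
    and h: "h < 1" and large: "real (card A) - h < norm (sum w A)"
  shows "\<exists>u. norm u = 1 \<and> (\<forall>i\<in>A. (norm (w i - u))\<^sup>2 \<le> 2 * h)"
proof -
  define u where "u = sgn (sum w A)"
  have "card A \<ge> 1" using A by (simp add: Suc_leI card_gt_0_iff)
  then have nz: "sum w A \<noteq> 0" using large h by auto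
  then have u: "norm u = 1" unfolding u_def by (simp add: norm_sgn)
  have "inner (sum w A) u = norm (sum w A)"
    unfolding u_def sgn_div_norm using nz by (simp add: dot_square_norm power2_eq_square)
  then have sum: "real (card A) - h < (\<Sum>i\<in>A. inner (w i) u)"
    using large by (simp add: inner_sum_left)
  have le1: "inner (w i) u \<le> 1" if "i \<in> A" for i
    using norm_cauchy_schwarz[of "w i" u] w[OF that] u by simp
  have "(norm (w i - u))\<^sup>2 \<le> 2 * h" if i: "i \<in> A" for i
  proof -
    have "(\<Sum>j\<in>A - {i}. inner (w j) u) \<le> real (card (A - {i})) * 1"
      using le1 by (intro sum_bounded_above) auto
    also have "\<dots> = real (card A) - 1"
      using of_nat_diff[OF \<open>card A \<ge> 1\<close>] card_Diff_singleton[OF i] by simp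
    finally have "inner (w i) u > 1 - h"
      using sum sum.remove[OF A(1) i, of "\<lambda>j. inner (w j) u"] by linarith
    moreover have "(norm (w i - u))\<^sup>2 = (norm (w i))\<^sup>2 + 1 - 2 * inner (w i) u"
      using u by (simp add: power2_norm_eq_inner inner_diff_left inner_diff_right inner_commute
          flip: norm_eq_1)
    moreover have "(norm (w i))\<^sup>2 \<le> 1" using w[OF i] by (simp add: power_le_one)
    ultimately show ?thesis by linarith
  qed
  then show ?thesis using u by blast
qed

text \<open>An abstract form of the canonical map followed by the isometry of the envelope onto
  \<open>c0_space\<close>. Only \<open>dual_J\<close> leads back from \<open>sup_norm (J x)\<close>
  to \<open>q\<close>, since \<open>dual_norm\<close> is a supremum over the unit ball of
  \<open>q\<close>. The sort \<open>real_inner\<close> lets \<open>near_extremal_sum_aligned\<close>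
  be applied to scalars.\<close>

locale c0_embedding = quasi_normed_space s X q
  for s :: "'k::{real_normed_field,real_inner} \<Rightarrow> 'v::ab_group_add \<Rightarrow> 'v" and X q +
  fixes J :: "'v \<Rightarrow> nat \<Rightarrow> 'k"
  assumes linear_J: "linear_map_on s X fun_scale J"
    and J_c0: "x \<in> X \<Longrightarrow> J x \<in> c0_space"
    and sup_norm_J_le: "x \<in> X \<Longrightarrow> sup_norm (J x) \<le> q x"
    and dense_J: "v \<in> c0_space \<Longrightarrow> e > 0 \<Longrightarrow> \<exists>x\<in>X. sup_norm (J x - v) < e"
    and dual_J: "f \<in> dual_space s X q \<Longrightarrow> x \<in> X \<Longrightarrow> norm (f x) \<le> dual_norm X q f * sup_norm (J x)"
begin

section \<open>Approximation and lifting along \<open>J\<close>\<close>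

lemma J_add: "x \<in> X \<Longrightarrow> y \<in> X \<Longrightarrow> J (x + y) n = J x n + J y n"
  and J_scale: "x \<in> X \<Longrightarrow> J (s c x) n = c * J x n"
  using linear_J unfolding linear_map_on_def fun_scale_def by auto

lemma J_diff: "x \<in> X \<Longrightarrow> y \<in> X \<Longrightarrow> J (x - y) = J x - J y"
  using linear_map_on_diff[OF vector_space_axioms subspace linear_J] .

lemma norm_J_le: "x \<in> X \<Longrightarrow> norm (J x n) \<le> sup_norm (J x)"
  using norm_le_sup_norm J_c0 by blast

text \<open>By density some \<open>J x\<close> is close to the vector with entries
  \<open>inverse (a n)\<close> for \<open>n < N\<close>; there the functional is almost
  \<open>N\<close> while the sup norm is almost \<open>1\<close>. With \<open>dual_J\<close> its
  dual norm is at least \<open>N\<close>, and the definition of \<open>dual_norm\<close> then yields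
  a point in the unit ball of \<open>q\<close> itself.\<close>

lemma exists_almost_extremal:
  assumes a: "\<And>n. norm (a n) = 1" and h: "h > 0"
  shows "\<exists>x\<in>X. q x \<le> 1 \<and> norm (\<Sum>n<N. a n * J x n) > real N - h"
proof -
  define f where "f x = (if x \<in> X then \<Sum>n<N. a n * J x n else 0)" for x
  have f_le: "norm (f x) \<le> real N * q x" if x: "x \<in> X" for x
  proof -
    have "norm (\<Sum>n<N. a n * J x n) \<le> (\<Sum>n<N. q x)"
      using norm_J_le[OF x] sup_norm_J_le[OF x]
      by (intro sum_norm_le) (auto simp: norm_mult a intro: order_trans)
    then show ?thesis using x by (simp add: f_def)
  qed
  have "linear_map_on s X (*) f"
    unfolding linear_map_on_def f_def
    by (simp add: add_in scale_in J_add J_scale algebra_simps sum.distrib sum_distrib_left)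
  then have f: "f \<in> dual_space s X q"
    unfolding dual_space_iff using f_le by (auto simp: f_def)
  have "real N \<le> dual_norm X q f"
  proof (rule ccontr)
    assume "\<not> real N \<le> dual_norm X q f"
    moreover define M where "M = dual_norm X q f"
    ultimately have M: "0 \<le> M" "M < real N" using dual_norm_nonneg[OF f] by auto
    \<comment> \<open>The two estimates of \<open>norm (f x)\<close> will give
      \<open>N - M \<le> (N + M) * e\<close>; this \<open>e\<close> makes the right-hand side less
      than \<open>2 * N * e = N - M\<close>.\<close>
    define e where "e = (real N - M) / (2 * real N)"
    have e: "e > 0" unfolding e_def using M by simp
    define v where "v n = (if n < N then inverse (a n) else 0)" for n
    have "v \<in> c0_space"
      unfolding c0_space_def v_def
      by (auto intro!: tendsto_eventually eventually_sequentiallyI[of N])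
    then obtain x where x: "x \<in> X" "sup_norm (J x - v) < e" using dense_J e by blast
    have near: "norm (J x n - v n) \<le> e" for n
      using norm_le_sup_norm[OF diff_c0_space[OF J_c0[OF x(1)] \<open>v \<in> c0_space\<close>], of n] x(2) by simp
    have "sup_norm (J x) \<le> 1 + e"
    proof (rule sup_norm_le)
      fix n
      have "norm (v n) \<le> 1" by (simp add: v_def norm_inverse a)
      then show "norm (J x n) \<le> 1 + e"
        using near[of n] norm_triangle_sub[of "J x n" "v n"] by linarith
    qed
    then have "norm (f x) \<le> M * (1 + e)"
      using dual_J[OF f x(1)] M(1) mult_left_mono[of _ _ M] unfolding M_def by (meson order_trans)
    moreover have "f x = of_nat N + (\<Sum>n<N. a n * (J x n - v n))"
    proof -
      have "a n * v n = 1" if "n < N" for n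
        using a[of n] that by (auto simp: v_def intro!: right_inverse)
      then show ?thesis
        using x(1) by (simp add: f_def right_diff_distrib sum_subtractf)
    qed
    moreover have "norm (\<Sum>n<N. a n * (J x n - v n)) \<le> (\<Sum>n<N. e)"
      using near by (intro sum_norm_le) (simp add: norm_mult a)
    ultimately have "real N - real N * e \<le> M * (1 + e)"
      using norm_diff_ineq[of "of_nat N :: 'k" "\<Sum>n<N. a n * (J x n - v n)"] by simp
    then have "real N - M \<le> (real N + M) * e" by (simp add: algebra_simps)
    also have "\<dots> < (2 * real N) * e" using M e by (intro mult_strict_right_mono) auto
    also have "\<dots> = real N - M" using M by (simp add: e_def)
    finally show False by simp
  qed
  moreover have "dual_norm X q f \<le> real N - h"
    if "\<And>x. x \<in> X \<Longrightarrow> q x \<le> 1 \<Longrightarrow> norm (f x) \<le> real N - h"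
    unfolding dual_norm_def
  proof (rule cSUP_least)
    show "{x \<in> X. q x \<le> 1} \<noteq> {}" using zero_in q_0 by force
  qed (use that in auto)
  ultimately obtain x where "x \<in> X" "q x \<le> 1" "norm (f x) > real N - h"
    using h by fastforce
  then show ?thesis unfolding f_def by (auto intro!: bexI[of _ x])
qed

text \<open>
  If \<open>J x\<close> almost agrees with the signs of \<open>y\<close> on the coordinates where \<open>y\<close> is not negligible,
  then \<open>(1/2) J x\<close> differs from \<open>y\<close> by hardly more than \<open>1/2\<close> there; its other coordinates are
  bounded by \<open>1/2\<close> because \<open>J\<close> is a contraction.
\<close>

lemma approx_step:
  assumes y: "y \<in> c0_space"
  shows "\<exists>x\<in>X. q x \<le> sup_norm y \<and> sup_norm (y - J x) \<le> 3 / 4 * sup_norm y"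
proof (cases "sup_norm y = 0")
  case True
  have "sup_norm (y - J 0) \<le> 0"
    using norm_le_sup_norm[OF y] True linear_0[OF linear_J] by (intro sup_norm_le) simp
  then show ?thesis using True zero_in q_0 by (intro bexI[of _ 0]) auto
next
  case False
  define r where "r = sup_norm y"
  have r: "r > 0" using False sup_norm_nonneg[OF y] unfolding r_def by simp
  obtain N0 where N0: "\<And>n. n \<ge> N0 \<Longrightarrow> norm (y n) < r / 4"
    using y r LIMSEQ_D[of y 0 "r / 4"] unfolding c0_space_def by auto
  \<comment> \<open>The successor makes \<open>{..<N}\<close> nonempty, as
    \<open>near_extremal_sum_aligned\<close> requires.\<close>
  define N where "N = Suc N0"
  \<comment> \<open>The value \<open>1\<close> at zeros of \<open>y\<close> keeps the modulus equal
    to \<open>1\<close> everywhere.\<close>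
  define sg where "sg n = (if y n = 0 then 1 else y n / of_real (norm (y n)))" for n
  have sg: "norm (sg n) = 1" for n by (auto simp: sg_def norm_divide)
  then have sg_nz: "sg n \<noteq> 0" for n using norm_zero zero_neq_one by metis
  have y_sg: "y n = of_real (norm (y n)) * sg n" for n by (simp add: sg_def)
  \<comment> \<open>The defect \<open>1 / 32\<close> is chosen so that \<open>2 * (1 / 32)\<close>
    is the square of \<open>1 / 4\<close>.\<close>
  obtain x where x: "x \<in> X" "q x \<le> 1"
    and large: "norm (\<Sum>n<N. inverse (sg n) * J x n) > real N - 1 / 32"
    using exists_almost_extremal[of "\<lambda>n. inverse (sg n)" "1 / 32" N] by (auto simp: norm_inverse sg)
  have Jx: "norm (J x n) \<le> 1" for n
    using norm_J_le[OF x(1), of n] sup_norm_J_le[OF x(1)] x(2) by linarith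
  define w where "w n = inverse (sg n) * J x n" for n
  have "\<exists>u. norm u = 1 \<and> (\<forall>n\<in>{..<N}. (norm (w n - u))\<^sup>2 \<le> 2 * (1 / 32))"
    by (rule near_extremal_sum_aligned) (use large Jx in \<open>auto simp: w_def norm_mult norm_inverse sg N_def\<close>)
  then obtain u where u: "norm u = 1" and wu: "\<And>n. n < N \<Longrightarrow> (norm (w n - u))\<^sup>2 \<le> (1 / 4)\<^sup>2"
    by (auto simp: power2_eq_square)
  have u_nz: "u \<noteq> 0" using u by auto
  \<comment> \<open>Only the modulus of the sum is controlled, so the signs are matched up to a
    common factor \<open>u\<close>, which \<open>inverse u\<close> removes. As
    \<open>norm (y n)\<close> lies between \<open>0\<close> and \<open>r\<close>, subtracting
    \<open>r / 2\<close> leaves at most \<open>r / 2\<close>; the misalignment adds at most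
    \<open>r / 8\<close>. On the remaining coordinates the bound is \<open>r / 4 + r / 2\<close>,
    which dictates the factor \<open>3 / 4\<close>.\<close>
  define c where "c = of_real (r / 2) * inverse u"
  have c: "norm c = r / 2" using r by (simp add: c_def norm_mult norm_inverse u)
  have "norm ((y - J (s c x)) n) \<le> 3 / 4 * r" for n
  proof (cases "n < N")
    case True
    have "J x n = sg n * w n" using sg_nz[of n] by (simp add: w_def)
    then have "(y - J (s c x)) n = of_real (norm (y n)) * sg n - c * (sg n * w n)"
      using J_scale[OF x(1), of c n] y_sg[of n] by simp
    also have "\<dots> = sg n * (of_real (norm (y n) - r / 2) + of_real (r / 2) * (inverse u * (u - w n)))"
      using u_nz by (simp add: c_def algebra_simps)
    finally have eq: "(y - J (s c x)) n =
      sg n * (of_real (norm (y n) - r / 2) + of_real (r / 2) * (inverse u * (u - w n)))" .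
    have "norm (of_real (norm (y n) - r / 2) :: 'k) \<le> r / 2"
      using norm_le_sup_norm[OF y, of n] norm_ge_zero[of "y n"] r unfolding r_def norm_of_real
      by linarith
    moreover have "norm (u - w n) \<le> 1 / 4"
      using power2_le_imp_le[OF wu[OF True]] by (simp add: norm_minus_commute)
    then have "norm (of_real (r / 2) * (inverse u * (u - w n))) \<le> r / 2 * (1 / 4)"
      using r unfolding norm_mult norm_of_real norm_inverse u by simp
    ultimately have "norm (of_real (norm (y n) - r / 2) + of_real (r / 2) * (inverse u * (u - w n)))
        \<le> 3 / 4 * r"
      using norm_triangle_ineq[of "of_real (norm (y n) - r / 2)"
          "of_real (r / 2) * (inverse u * (u - w n))"] r by linarith
    then show ?thesis unfolding eq norm_mult sg by simp
  next
    case False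
    then have "norm (y n) \<le> r / 4" using N0[of n] by (simp add: N_def)
    moreover have "norm (J (s c x) n) \<le> r / 2"
      using J_scale[OF x(1), of c n] Jx[of n] r by (simp add: norm_mult c)
    ultimately show ?thesis using norm_triangle_ineq4[of "y n" "J (s c x) n"] r by simp
  qed
  then have "sup_norm (y - J (s c x)) \<le> 3 / 4 * sup_norm y"
    unfolding r_def by (rule sup_norm_le)
  moreover have "q (s c x) \<le> sup_norm y"
    unfolding q_scale[OF x(1)] c using mult_left_le[OF x(2), of "r / 2"] r by (simp add: r_def)
  ultimately show ?thesis using scale_in x(1) by blast
qed

text \<open>Each application of \<open>approx_step\<close> to the remaining error gains a factor
  \<open>3 / 4\<close> and turns \<open>C\<close> into \<open>\<Delta> * (C + 1)\<close>. The growth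
  of \<open>C\<close> with \<open>m\<close> is harmless because \<open>m\<close> will be fixed and
  \<open>C\<close> does not depend on \<open>y\<close>.\<close>

lemma approx_power:
  "\<exists>C\<ge>0. \<forall>y\<in>c0_space. \<exists>x\<in>X. q x \<le> C * sup_norm y \<and> sup_norm (y - J x) \<le> (3 / 4) ^ m * sup_norm y"
proof (induction m)
  case 0
  have "\<exists>x\<in>X. q x \<le> 0 * sup_norm y \<and> sup_norm (y - J x) \<le> (3 / 4) ^ 0 * sup_norm y" for y
    using zero_in q_0 linear_0[OF linear_J] by (intro bexI[of _ 0]) auto
  then show ?case by blast
next
  case (Suc m)
  then obtain C where C: "C \<ge> 0" and ex: "\<And>y. y \<in> c0_space \<Longrightarrow>
      \<exists>x\<in>X. q x \<le> C * sup_norm y \<and> sup_norm (y - J x) \<le> (3 / 4) ^ m * sup_norm y"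
    by blast
  obtain \<Delta> where \<Delta>: "\<Delta> \<ge> 1" "\<And>x y. x \<in> X \<Longrightarrow> y \<in> X \<Longrightarrow> q (x + y) \<le> \<Delta> * (q x + q y)"
    using quasi_triangle by blast
  have "\<exists>z\<in>X. q z \<le> \<Delta> * (C + 1) * sup_norm y \<and> sup_norm (y - J z) \<le> (3 / 4) ^ Suc m * sup_norm y"
    if y: "y \<in> c0_space" for y
  proof -
    obtain x where x: "x \<in> X" "q x \<le> C * sup_norm y" "sup_norm (y - J x) \<le> (3 / 4) ^ m * sup_norm y"
      using ex[OF y] by blast
    have y': "y - J x \<in> c0_space" using diff_c0_space y J_c0 x(1) by blast
    obtain x' where x': "x' \<in> X" "q x' \<le> sup_norm (y - J x)"
      "sup_norm ((y - J x) - J x') \<le> 3 / 4 * sup_norm (y - J x)"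
      using approx_step[OF y'] by blast
    have "(3 / 4 :: real) ^ m \<le> 1" by (intro power_le_one) auto
    then have "(3 / 4) ^ m * sup_norm y \<le> sup_norm y"
      using sup_norm_nonneg[OF y] mult_right_mono by fastforce
    then have "q x + q x' \<le> (C + 1) * sup_norm y" using x x' by (simp add: distrib_right)
    then have "q (x + x') \<le> \<Delta> * ((C + 1) * sup_norm y)"
      using \<Delta>(2)[OF x(1) x'(1)] mult_left_mono[of _ _ \<Delta>] \<Delta>(1) by (meson order_trans zero_le_one)
    moreover have "J (x + x') = J x + J x'"
      using linear_J x(1) x'(1) unfolding linear_map_on_def by blast
    then have "sup_norm (y - J (x + x')) \<le> 3 / 4 * sup_norm (y - J x)"
      using x'(3) by (simp add: algebra_simps)
    then have "sup_norm (y - J (x + x')) \<le> (3 / 4) ^ Suc m * sup_norm y" using x(3) by simp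
    ultimately show ?thesis using add_in x(1) x'(1) by (auto simp: mult.assoc)
  qed
  moreover have "0 \<le> \<Delta> * (C + 1)" using \<Delta>(1) C by simp
  ultimately show ?case by blast
qed

text \<open>Successive approximation as in the open mapping theorem: the errors decay geometrically,
  and the sum of the corrections converges in \<open>X\<close> by completeness to a
  preimage.\<close>

lemma bounded_lifting:
  assumes complete: "complete_wrt X q"
  shows "\<exists>C. \<forall>y\<in>c0_space. \<exists>x\<in>X. J x = y \<and> q x \<le> C * sup_norm y"
proof -
  obtain \<Delta> where \<Delta>: "\<Delta> \<ge> 1" "\<And>x y. x \<in> X \<Longrightarrow> y \<in> X \<Longrightarrow> q (x + y) \<le> \<Delta> * (q x + q y)"
    using quasi_triangle by blast
  \<comment> \<open>Grouping \<open>m\<close> steps makes the contraction factor beat the constant of the quasi-triangle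
    inequality, which the plain factor \<open>3/4\<close> need not do.\<close>
  obtain m where m: "(3 / 4) ^ m < 1 / (2 * \<Delta>)"
    using real_arch_pow_inv[of "1 / (2 * \<Delta>)" "3 / 4"] \<Delta>(1) by auto
  define \<rho> :: real where "\<rho> = (3 / 4) ^ m"
  have \<rho>: "0 < \<rho>" "\<Delta> * \<rho> \<le> 1 / 2"
    using m \<Delta>(1) unfolding \<rho>_def by (auto simp: field_simps)
  have "\<rho> \<le> \<Delta> * \<rho>" using \<Delta>(1) \<rho>(1) by simp
  then have \<rho>1: "\<rho> < 1" using \<rho>(2) by linarith
  obtain C where C: "C \<ge> 0" and ex: "\<And>y. y \<in> c0_space \<Longrightarrow>
      \<exists>x\<in>X. q x \<le> C * sup_norm y \<and> sup_norm (y - J x) \<le> \<rho> * sup_norm y"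
    using approx_power[of m] unfolding \<rho>_def by blast
  then obtain g where g: "\<And>y. y \<in> c0_space \<Longrightarrow> g y \<in> X" "\<And>y. y \<in> c0_space \<Longrightarrow> q (g y) \<le> C * sup_norm y"
    "\<And>y. y \<in> c0_space \<Longrightarrow> sup_norm (y - J (g y)) \<le> \<rho> * sup_norm y"
    by metis
  have "\<exists>x\<in>X. J x = y \<and> q x \<le> 2 * \<Delta>\<^sup>2 * C * sup_norm y" if y: "y \<in> c0_space" for y
  proof -
    define R where "R = sup_norm y"
    have R: "R \<ge> 0" using sup_norm_nonneg[OF y] unfolding R_def .
    \<comment> \<open>\<open>z n\<close> is the error left after \<open>n\<close> corrections, and
      \<open>a n\<close> below is the next correction.\<close>
    define z where "z n = ((\<lambda>v. v - J (g v)) ^^ n) y" for n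
    have z_Suc: "z (Suc n) = z n - J (g (z n))" for n by (simp add: z_def)
    have z_c0: "z n \<in> c0_space" for n
    proof (induction n)
      case 0
      show ?case using y by (simp add: z_def)
    next
      case (Suc n)
      then show ?case unfolding z_Suc using g(1) J_c0 diff_c0_space by blast
    qed
    have z_le: "sup_norm (z n) \<le> \<rho> ^ n * R" for n
    proof (induction n)
      case (Suc n)
      have "sup_norm (z (Suc n)) \<le> \<rho> * sup_norm (z n)" using g(3)[OF z_c0] z_Suc by simp
      also have "\<dots> \<le> \<rho> * (\<rho> ^ n * R)" using Suc \<rho>(1) by simp
      finally show ?case by simp
    qed (simp add: z_def R_def)
    define a where "a n = g (z n)" for n
    have aX: "a n \<in> X" for n unfolding a_def using g(1) z_c0 by blast
    have a_le: "q (a n) \<le> C * (\<rho> ^ n * R)" for n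
      using g(2)[OF z_c0, of n] mult_left_mono[OF z_le C, of n] unfolding a_def by linarith
    have sum_X: "sum a A \<in> X" for A
      by (induction A rule: infinite_finite_induct) (auto simp: zero_in add_in aX)
    \<comment> \<open>Splitting off the first term costs one factor \<open>\<Delta>\<close>, and the
      rest starts at \<open>Suc i\<close>, hence is smaller by \<open>\<rho>\<close>. The constant
      reproduces itself since
      \<open>\<Delta> * (1 + 2 * (\<Delta> * \<rho>)) \<le> 2 * \<Delta>\<close>, so the bound does
      not depend on the length \<open>l\<close>.\<close>
    have block: "q (\<Sum>k=i..<i+l. a k) \<le> 2 * \<Delta> * C * \<rho> ^ i * R" for i l
    proof (induction l arbitrary: i)
      case 0
      then show ?case using q_0 \<Delta>(1) C \<rho>(1) R by simp
    next
      case (Suc l)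
      have nn: "0 \<le> C * (\<rho> ^ i * R)" using C \<rho>(1) R by simp
      have "(\<Sum>k=i..<i+Suc l. a k) = a i + (\<Sum>k=Suc i..<Suc i+l. a k)"
        by (simp add: sum.atLeast_Suc_lessThan)
      then have "q (\<Sum>k=i..<i+Suc l. a k) \<le> \<Delta> * (q (a i) + q (\<Sum>k=Suc i..<Suc i+l. a k))"
        by (simp only: \<Delta>(2)[OF aX sum_X])
      also have "\<dots> \<le> \<Delta> * (C * (\<rho> ^ i * R) + 2 * \<Delta> * C * \<rho> ^ Suc i * R)"
        using \<Delta>(1) by (intro mult_left_mono add_mono a_le Suc) auto
      also have "\<dots> = \<Delta> * (C * (\<rho> ^ i * R)) * (1 + 2 * (\<Delta> * \<rho>))" by (simp add: algebra_simps)
      also have "\<dots> \<le> \<Delta> * (C * (\<rho> ^ i * R)) * 2"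
        using \<rho>(2) \<Delta>(1) nn by (intro mult_left_mono) auto
      finally show ?case by (simp add: algebra_simps)
    qed
    define S where "S n = (\<Sum>k<n. a k)" for n
    have SX: "S n \<in> X" for n unfolding S_def by (rule sum_X)
    have S_diff: "q (S n - S i) \<le> 2 * \<Delta> * C * \<rho> ^ i * R" if "i \<le> n" for i n
    proof -
      obtain l where "n = i + l" using \<open>i \<le> n\<close> le_Suc_ex by blast
      then have "S n - S i = (\<Sum>k=i..<i+l. a k)"
        unfolding S_def lessThan_atLeast0 by (subst sum_diff_nat_ivl) auto
      then show ?thesis using block by simp
    qed
    have lim0: "(\<lambda>i. K * \<rho> ^ i * R) \<longlonglongrightarrow> 0" for K
      using tendsto_mult_right[OF tendsto_mult_left[OF LIMSEQ_realpow_zero], of \<rho> K R] \<rho>(1) \<rho>1 by simp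
    have "\<exists>N. \<forall>m\<ge>N. \<forall>n\<ge>N. q (S m - S n) < e" if e: "e > 0" for e
    proof -
      obtain N where N: "\<And>i. i \<ge> N \<Longrightarrow> 2 * \<Delta> * C * \<rho> ^ i * R < e"
        using order_tendstoD(2)[OF lim0 e] unfolding eventually_sequentially by blast
      have "q (S m - S n) < e" if "m \<ge> N" "n \<ge> N" for m n
        using S_diff[of n m] S_diff[of m n] N[of m] N[of n] that q_minus_commute[OF SX SX, of m n]
        by (cases "n \<le> m") auto
      then show ?thesis by blast
    qed
    moreover have "range S \<subseteq> X" using SX by blast
    ultimately obtain x where x: "x \<in> X" and lim: "(\<lambda>n. q (S n - x)) \<longlonglongrightarrow> 0"
      using complete unfolding complete_wrt_def by blast
    \<comment> \<open>As \<open>q\<close> need not be continuous, \<open>q (S n)\<close> need not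
      tend to \<open>q x\<close>; the quasi-triangle inequality for \<open>S n + (x - S n)\<close>
      is used instead, at the price of a second factor \<open>\<Delta>\<close>.\<close>
    have "q x \<le> \<Delta> * (2 * \<Delta> * C * R + 0)"
    proof (rule tendsto_lowerbound[of "\<lambda>n. \<Delta> * (2 * \<Delta> * C * R + q (S n - x))"])
      show "((\<lambda>n. \<Delta> * (2 * \<Delta> * C * R + q (S n - x))) \<longlongrightarrow> \<Delta> * (2 * \<Delta> * C * R + 0)) sequentially"
        by (intro tendsto_intros lim)
      have "q x \<le> \<Delta> * (2 * \<Delta> * C * R + q (S n - x))" for n
      proof -
        have "q (S n + (x - S n)) \<le> \<Delta> * (q (S n) + q (x - S n))"
          by (rule \<Delta>(2)[OF SX diff_in[OF x SX]])
        also have "\<dots> \<le> \<Delta> * (2 * \<Delta> * C * R + q (S n - x))"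
          using S_diff[of 0 n] q_minus_commute[OF SX x, of n] \<Delta>(1)
          by (intro mult_left_mono) (auto simp: S_def)
        finally show ?thesis by simp
      qed
      then show "\<forall>\<^sub>F n in sequentially. q x \<le> \<Delta> * (2 * \<Delta> * C * R + q (S n - x))" by simp
    qed simp
    moreover have "J x = y"
    proof
      have JS: "J (S n) = y - z n" for n
      proof (induction n)
        case 0
        then show ?case using linear_0[OF linear_J] by (simp add: S_def z_def)
      next
        case (Suc n)
        have "J (S n + a n) = J (S n) + J (a n)"
          using linear_J SX aX unfolding linear_map_on_def by blast
        then show ?case using Suc z_Suc[of n] by (simp add: S_def a_def fun_eq_iff)
      qed
      fix k
      \<comment> \<open>The factor \<open>1\<close> makes the last summand an instance of
        \<open>lim0\<close>.\<close>
      have "norm (J x k - y k) \<le> q (S n - x) + 1 * \<rho> ^ n * R" for n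
      proof -
        have "y = J (S n) + z n" using JS by simp
        then have "J x k - y k = - (J (S n - x) k + z n k)" using J_diff[OF SX x, of n] by simp
        then have "norm (J x k - y k) \<le> norm (J (S n - x) k) + norm (z n k)"
          by (metis norm_minus_cancel norm_triangle_ineq)
        then show ?thesis
          using norm_J_le[OF diff_in[OF SX x], of n k] sup_norm_J_le[OF diff_in[OF SX x], of n]
            norm_le_sup_norm[OF z_c0, of n k] z_le[of n] by linarith
      qed
      moreover have "(\<lambda>n. q (S n - x) + 1 * \<rho> ^ n * R) \<longlonglongrightarrow> 0 + 0"
        by (intro tendsto_add lim lim0)
      ultimately have "norm (J x k - y k) \<le> 0"
        by (intro tendsto_lowerbound[of "\<lambda>n. q (S n - x) + 1 * \<rho> ^ n * R"]) auto
      then show "J x k = y k" by simp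
    qed
    ultimately show ?thesis using x by (auto simp: R_def power2_eq_square mult.assoc mult.left_commute)
  qed
  then show ?thesis by blast
qed

end

section \<open>Spaces whose Banach envelope is isometric to \<open>c0_space\<close>\<close>

lemma locally_convex_space_if_envelope_c0:
  fixes s :: "'k::{real_normed_field,real_inner} \<Rightarrow> 'v::ab_group_add \<Rightarrow> 'v"
  assumes X: "quasi_banach_space s X q" and sep: "separating_dual s X q"
    and iso: "linearly_isometric fun_scale (banach_envelope s X q) (bidual_norm s X q)
      fun_scale (c0_space :: (nat \<Rightarrow> 'k) set) sup_norm"
  shows "locally_convex_space s X q"
proof -
  interpret quasi_normed_space s X q
    using X unfolding quasi_banach_space_def quasi_normed_space_def quasi_normed_space_axioms_def
    by blast
  interpret B: quasi_normed_space fun_scale "bidual_space s X q" "bidual_norm s X q"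
    by (rule quasi_normed_space_bidual)
  let ?E = "banach_envelope s X q" and ?p = "bidual_norm s X q" and ?d = "canonical_map s X q"
  obtain T where T: "linear_map_on fun_scale ?E fun_scale T" "bij_betw T ?E c0_space"
    "\<And>z. z \<in> ?E \<Longrightarrow> sup_norm (T z) = ?p z"
    using iso unfolding linearly_isometric_def by blast
  have d_add: "?d (x + y) = ?d x + ?d y" and d_scale: "?d (s c x) = fun_scale c (?d x)"
    if "x \<in> X" "y \<in> X" for x y c
    using linear_canonical_map that unfolding linear_map_on_def by blast+
  define J where "J x = T (?d x)" for x
  have sup_J: "sup_norm (J x) = ?p (?d x)" if "x \<in> X" for x
    unfolding J_def using T(3) canonical_map_in_banach_envelope[OF that] by blast
  interpret c0_embedding s X q J
  proof
    show "linear_map_on s X fun_scale J"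
      using T(1) d_add d_scale canonical_map_in_banach_envelope
      unfolding J_def linear_map_on_def by simp
    show "J x \<in> c0_space" if "x \<in> X" for x
      unfolding J_def using canonical_map_in_banach_envelope[OF that] T(2) bij_betwE by blast
    show "sup_norm (J x) \<le> q x" if "x \<in> X" for x
      using sup_J[OF that] bidual_norm_canonical_map_le[OF that] by simp
    show "norm (f x) \<le> dual_norm X q f * sup_norm (J x)"
      if "f \<in> dual_space s X q" "x \<in> X" for f x
      using norm_le_dual_norm_bidual_norm[OF that] sup_J[OF that(2)] by simp
    show "\<exists>x\<in>X. sup_norm (J x - v) < e" if v: "v \<in> c0_space" and e: "e > 0" for v e
    proof -
      obtain z where z: "z \<in> ?E" "v = T z" using v T(2) unfolding bij_betw_def by blast
      obtain x where x: "x \<in> X" "?p (?d x - z) < e" using z(1) e unfolding banach_envelope_iff by blast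
      \<comment> \<open>The envelope is a subspace, so the difference lies in the domain of
        \<open>T\<close> and its norm is preserved.\<close>
      have "J x - v = T (?d x - z)"
        unfolding J_def z(2)
        using linear_map_on_diff[OF vector_space_fun_scale subspace_banach_envelope T(1)
            canonical_map_in_banach_envelope[OF x(1)] z(1)] by simp
      moreover have "?d x - z \<in> ?E"
        using B.subspace_diff[OF subspace_banach_envelope canonical_map_in_banach_envelope[OF x(1)] z(1)] .
      ultimately have "sup_norm (J x - v) < e" using T(3) x(2) by metis
      then show ?thesis using x(1) by blast
    qed
  qed
  \<comment> \<open>The separating dual makes the envelope norm definite on \<open>X\<close>, hence
    a norm and not merely a seminorm.\<close>
  have d_inj: "x = 0" if x: "x \<in> X" "?d x = 0" for x
  proof (rule ccontr)
    assume "x \<noteq> 0"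
    then obtain f where "f \<in> dual_space s X q" "f x \<noteq> 0"
      using sep x(1) unfolding separating_dual_def by blast
    then show False using fun_cong[OF x(2), of f] by (simp add: canonical_map_def)
  qed
  have p_0: "?p (?d x) = 0 \<longleftrightarrow> x = 0" if "x \<in> X" for x
    using B.q_eq_0_iff[OF canonical_map_in_bidual[OF that]] d_inj[OF that]
      linear_0[OF linear_canonical_map] by auto
  have "norm_on s X (\<lambda>x. ?p (?d x))"
  proof -
    have tri: "?p (?d (x + y)) \<le> ?p (?d x) + ?p (?d y)" if "x \<in> X" "y \<in> X" for x y
      using norm_on_bidual_norm canonical_map_in_bidual that d_add[OF that]
      unfolding norm_on_def by simp
    moreover have "?p (?d (s c x)) = norm c * ?p (?d x)" if "x \<in> X" for c x
      using B.q_scale[OF canonical_map_in_bidual[OF that]] d_scale[OF that that] by simp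
    ultimately show ?thesis
      unfolding norm_on_def quasi_norm_on_def
      using p_0 B.q_nonneg[OF canonical_map_in_bidual] by (auto intro!: exI[of _ 1])
  qed
  moreover have complete: "complete_wrt X q" using X unfolding quasi_banach_space_def by blast
  moreover obtain C where
    C: "\<And>y. y \<in> c0_space \<Longrightarrow> \<exists>x\<in>X. J x = y \<and> q x \<le> C * sup_norm y"
    using bounded_lifting[OF complete] by blast
  \<comment> \<open>The bounded lift of \<open>J x\<close> must be \<open>x\<close> itself by
    injectivity, so its bound is a bound on \<open>q x\<close>.\<close>
  have "q x \<le> C * ?p (?d x)" if x: "x \<in> X" for x
  proof -
    obtain z where z: "z \<in> X" "J z = J x" "q z \<le> C * sup_norm (J x)" using C[OF J_c0[OF x]] by blast
    have "J (z - x) = 0" using J_diff[OF z(1) x] z(2) by simp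
    then have "sup_norm (J (z - x)) \<le> 0" by (intro sup_norm_le) simp
    then have "?p (?d (z - x)) = 0"
      using sup_J[OF diff_in[OF z(1) x]] sup_norm_nonneg[OF J_c0[OF diff_in[OF z(1) x]]] by simp
    then have "z = x" using p_0[OF diff_in[OF z(1) x]] by simp
    then show ?thesis using z sup_J[OF x] by simp
  qed
  ultimately show ?thesis
    using locally_convex_space_if_equivalent_norm bidual_norm_canonical_map_le by blast
qed

theorem proposition6:
  "(\<forall>(s :: real \<Rightarrow> 'a::ab_group_add \<Rightarrow> 'a) X q.
      quasi_banach_space s X q \<and> separating_dual s X q \<and>
      linearly_isometric fun_scale (banach_envelope s X q) (bidual_norm s X q)
        fun_scale (c0_space :: (nat \<Rightarrow> real) set) sup_norm \<longrightarrow>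
      locally_convex_space s X q) \<and>
   (\<forall>(s :: complex \<Rightarrow> 'b::ab_group_add \<Rightarrow> 'b) X q.
      quasi_banach_space s X q \<and> separating_dual s X q \<and>
      linearly_isometric fun_scale (banach_envelope s X q) (bidual_norm s X q)
        fun_scale (c0_space :: (nat \<Rightarrow> complex) set) sup_norm \<longrightarrow>
      locally_convex_space s X q)"
  \<comment> \<open>Both \<open>real\<close> and \<open>complex\<close> are instances of
    \<open>real_normed_field\<close> and \<open>real_inner\<close>.\<close>
  by (intro conjI allI impI; elim conjE; rule locally_convex_space_if_envelope_c0)

end
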